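(* Let $l$ be a monitored layer, let $\phi_l\in\mathbb{R}^{p}$ be the current (vectorized) LoRA parameters of that layer, and let $v\in\mathbb{R}^{p}$ be a parameter direction. Let $J_l=\partial z_l/\partial\phi_l$, $H_l=\partial h_l/\partial z_l$, and let $$D_l=\operatorname{Diag}\left(\mathbb{I}\left[m\mathbf{1}-\tau_l\odot z_l>0\right]\right)$$ be the diagonal $0/1$ mask of the coordinates whose margin constraint is currently violated, all evaluated at $\phi_l$. If $$H_lJ_lv=0\qquad\text{and}\qquad D_lJ_lv\neq 0,$$ then $v$ is locally unobservable through the model output but observable through the active boundary constraints.
   Context: All parameters other than $\phi_l$ are held fixed, as is the input. The map $\phi_l\mapsto z_l(\phi_l)\in\mathbb{R}^{n}$ is the (flattened) pre-activation vector of layer $l$, and the model output is $o(\phi_l)=h_l(z_l(\phi_l))\in\mathbb{R}^{c}$, where $h_l$ is the downstream computation from the layer-$l$ pre-activation to the output. The map $z_l$ is differentiable at the current $\phi_l$ with Jacobian $J_l\in\mathbb{R}^{n\times p}$, and $h_l$ is differentiable at $z_l=z_l(\phi_l)$ with Jacobian $H_l\in\mathbb{R}^{c\times n}$. The vector $\tau_l\in\{-1,+1\}^{n}$ is a fixed vector of target signs and $m>0$ is a fixed margin. $\odot$ is the coordinatewise product, $\mathbf{1}$ the all-ones vector, and $\mathbb{I}[\cdot]$ the coordinatewise indicator. The boundary residual is $r_l(\phi_l)=[\,m\mathbf{1}-\tau_l\odot z_l(\phi_l)\,]_+\in\mathbb{R}^n$, where $[\cdot]_+$ is the coordinatewise positive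 part. A coordinate $j$ is called active (its margin constraint is violated) at $\phi_l$ if $m-\tau_{l,j}z_{l,j}(\phi_l)>0$. A direction $v$ is locally unobservable through the model output if the output has no first-order sensitivity to $v$, i.e. $o(\phi_l+\epsilon v)=o(\phi_l)+o(\epsilon)$ as $\epsilon\to0^+$, where the last term denotes a quantity that is little-o of $\epsilon$. A direction $v$ is observable through the active boundary constraints if the first-order change along $v$ of at least one active residual is nonzero, i.e. there is an active coordinate $j$ for which $\lim_{\epsilon\to0^+}\frac{r_{l,j}(\phi_l+\epsilon v)-r_{l,j}(\phi_l)}{\epsilon}$ exists and is nonzero. *)

theory Defs
  imports "HOL-Analysis.Analysis" "HOL-Library.Landau_Symbols"
begin

text \<open>
  Throughout, \<open>1\<close> and \<open>*\<close> at type \<open>real ^ 'n\<close> are the library's all-ones vector and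
  coordinatewise product, while \<open>**\<close> and \<open>*v\<close> are the matrix product and the
  matrix-vector product.
\<close>

definition Diag :: "real ^ 'n \<Rightarrow> real ^ 'n ^ 'n" where
  "Diag d = (\<chi> i j. if i = j then d $ i else 0)"

definition pos_part :: "real ^ 'n \<Rightarrow> real ^ 'n" where
  "pos_part x = (\<chi> j. max 0 (x $ j))"

definition pos_indicator :: "real ^ 'n \<Rightarrow> real ^ 'n" where
  "pos_indicator x = (\<chi> j. of_bool (x $ j > 0))"

definition margin_gap :: "real \<Rightarrow> real ^ 'n \<Rightarrow> real ^ 'n \<Rightarrow> real ^ 'n" where
  "margin_gap m \<tau> y = m *\<^sub>R 1 - \<tau> * y"

definition active_mask :: "real \<Rightarrow> real ^ 'n \<Rightarrow> real ^ 'n \<Rightarrow> real ^ 'n ^ 'n" where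
  "active_mask m \<tau> y = Diag (pos_indicator (margin_gap m \<tau> y))"

definition boundary_residual ::
    "real \<Rightarrow> real ^ 'n \<Rightarrow> (real ^ 'p \<Rightarrow> real ^ 'n) \<Rightarrow> real ^ 'p \<Rightarrow> real ^ 'n" where
  "boundary_residual m \<tau> z \<phi> = pos_part (margin_gap m \<tau> (z \<phi>))"

definition active_coord ::
    "real \<Rightarrow> real ^ 'n \<Rightarrow> (real ^ 'p \<Rightarrow> real ^ 'n) \<Rightarrow> real ^ 'p \<Rightarrow> 'n \<Rightarrow> bool" where
  "active_coord m \<tau> z \<phi> j \<longleftrightarrow> m - \<tau> $ j * z \<phi> $ j > 0"

text \<open>
  The Landau symbols of the library are for functions into a normed field, so the
  little-o condition on the vector-valued output increment is stated for its norm.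
\<close>

definition locally_unobservable ::
    "(real ^ 'p \<Rightarrow> real ^ 'c) \<Rightarrow> real ^ 'p \<Rightarrow> real ^ 'p \<Rightarrow> bool" where
  "locally_unobservable out \<phi> v \<longleftrightarrow>
     (\<lambda>\<epsilon>::real. norm (out (\<phi> + \<epsilon> *\<^sub>R v) - out \<phi>)) \<in> o[at_right 0](\<lambda>\<epsilon>. \<epsilon>)"

definition boundary_observable ::
    "real \<Rightarrow> real ^ 'n \<Rightarrow> (real ^ 'p \<Rightarrow> real ^ 'n) \<Rightarrow> real ^ 'p \<Rightarrow> real ^ 'p \<Rightarrow> bool" where
  "boundary_observable m \<tau> z \<phi> v \<longleftrightarrow>
     (\<exists>j. active_coord m \<tau> z \<phi> j \<and>
        (\<exists>L. L \<noteq> 0 \<and>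
          ((\<lambda>\<epsilon>. (boundary_residual m \<tau> z (\<phi> + \<epsilon> *\<^sub>R v) $ j
                  - boundary_residual m \<tau> z \<phi> $ j) / \<epsilon>) \<longlongrightarrow> L) (at_right 0)))"

end

theory Submission
  imports Defs
begin

text \<open>Both claims reduce to one-sided directional derivatives along \<open>v\<close>. By the
  chain rule the output has derivative \<open>H J v = 0\<close> along \<open>v\<close>, so its
  increment is o(\<epsilon>) (\<open>locally_unobservable_if_derivative_zero\<close>). Since the
  mask is diagonal with 0/1 entries, \<open>D J v\<close> being nonzero yields an active coordinate
  \<open>j\<close> with \<open>(J v) $ j\<close> nonzero (\<open>active_mask_mult_nth\<close>). At
  an active coordinate the gap is strictly positive, so by continuity the positive part acts as the
  identity nearby and the kink at 0 is never met. The residual then has slope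
  \<open>- \<tau> $ j * (J v) $ j\<close> (\<open>active_residual_directional_limit\<close>),
  nonzero because \<open>\<tau> $ j\<close> is a sign.\<close>

lemma has_derivative_directional_limit:
  fixes f :: "'a::real_normed_vector \<Rightarrow> 'b::real_normed_vector"
  assumes "(f has_derivative f') (at x)"
  shows "((\<lambda>\<epsilon>. (f (x + \<epsilon> *\<^sub>R v) - f x) /\<^sub>R \<epsilon>) \<longlongrightarrow> f' v) (at_right 0)"
proof -
  have "((\<lambda>\<epsilon>::real. x + \<epsilon> *\<^sub>R v) has_derivative (\<lambda>\<epsilon>. \<epsilon> *\<^sub>R v)) (at_right 0)"
    by (auto intro!: derivative_eq_intros)
  moreover have "(f has_derivative f') (at (x + 0 *\<^sub>R v))"
    using assms by simp
  ultimately have "((\<lambda>\<epsilon>. f (x + \<epsilon> *\<^sub>R v)) has_derivative (\<lambda>\<epsilon>. f' (\<epsilon> *\<^sub>R v))) (at_right 0)"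
    by (rule has_derivative_compose)
  then have "((\<lambda>\<epsilon>. f (x + \<epsilon> *\<^sub>R v)) has_derivative (\<lambda>\<epsilon>. \<epsilon> *\<^sub>R f' v)) (at_right 0)"
    using linear_scale[OF has_derivative_linear[OF assms]] by simp
  \<comment> \<open>The definition of the derivative normalises the remainder by the norm of the
    increment, here \<bar>\<epsilon>\<bar>; to the right of 0 this is \<epsilon> itself, so the
    linear term becomes the constant \<open>f' v\<close>.\<close>
  then have "((\<lambda>\<epsilon>. (f (x + \<epsilon> *\<^sub>R v) - f x - \<epsilon> *\<^sub>R f' v) /\<^sub>R \<bar>\<epsilon>\<bar>) \<longlongrightarrow> 0) (at_right 0)"
    by (simp add: has_derivative_within divide_inverse_commute algebra_simps)
  then have "((\<lambda>\<epsilon>. (f (x + \<epsilon> *\<^sub>R v) - f x) /\<^sub>R \<epsilon> - f' v) \<longlongrightarrow> 0) (at_right 0)"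
    by (rule Lim_transform_eventually)
      (auto intro!: eventually_at_right_less[THEN eventually_mono] simp: scaleR_diff_right)
  then show ?thesis
    by (simp add: LIM_zero_iff)
qed

text \<open>The increment divided by \<epsilon> tends to \<open>out' v = 0\<close>; as \<epsilon> is
  nonzero to the right of 0, this limit is the little-o condition.\<close>

lemma locally_unobservable_if_derivative_zero:
  assumes "(out has_derivative out') (at \<phi>)" and "out' v = 0"
  shows "locally_unobservable out \<phi> v"
proof -
  have "((\<lambda>\<epsilon>. norm ((out (\<phi> + \<epsilon> *\<^sub>R v) - out \<phi>) /\<^sub>R \<epsilon>)) \<longlongrightarrow> 0) (at_right 0)"
    using has_derivative_directional_limit[OF assms(1), of v] assms(2)
    by (intro tendsto_norm_zero) simp
  then have "((\<lambda>\<epsilon>. norm (out (\<phi> + \<epsilon> *\<^sub>R v) - out \<phi>) / \<epsilon>) \<longlongrightarrow> 0) (at_right 0)"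
    by (rule Lim_transform_eventually)
      (auto intro!: eventually_at_right_less[THEN eventually_mono] simp: divide_inverse_commute)
  then show ?thesis
    unfolding locally_unobservable_def
    by (intro smalloI_tendsto)
      (auto intro!: eventually_at_right_less[THEN eventually_mono])
qed

lemma boundary_residual_nth:
  "boundary_residual m \<tau> z \<phi> $ j = max 0 (m - \<tau> $ j * z \<phi> $ j)"
  by (simp add: boundary_residual_def pos_part_def margin_gap_def)

lemma active_mask_mult_nth:
  "(active_mask m \<tau> (z \<phi>) *v y) $ j = of_bool (active_coord m \<tau> z \<phi> j) * y $ j"
  by (simp add: active_mask_def Diag_def pos_indicator_def margin_gap_def active_coord_def
      matrix_vector_mult_def if_distrib[of "\<lambda>x. x * _"] cong: if_cong)

text \<open>Activity is an open condition, so it persists for small \<epsilon>; there the residual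
  equals the affine gap \<open>m - \<tau> $ j * z x $ j\<close>, and the constant \<open>m\<close>
  cancels in the difference quotient.\<close>

lemma active_residual_directional_limit:
  fixes z :: "real ^ 'p \<Rightarrow> real ^ 'n"
  assumes z: "(z has_derivative z') (at \<phi>)" and active: "active_coord m \<tau> z \<phi> j"
  shows "((\<lambda>\<epsilon>. (boundary_residual m \<tau> z (\<phi> + \<epsilon> *\<^sub>R v) $ j
             - boundary_residual m \<tau> z \<phi> $ j) / \<epsilon>) \<longlongrightarrow> - (\<tau> $ j * z' v $ j)) (at_right 0)"
proof -
  let ?gap = "\<lambda>x. m - \<tau> $ j * z x $ j"
  have pos: "?gap \<phi> > 0"
    using active by (simp add: active_coord_def)
  have "((\<lambda>\<epsilon>::real. \<phi> + \<epsilon> *\<^sub>R v) \<longlongrightarrow> \<phi> + 0 *\<^sub>R v) (at_right 0)"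
    by (intro tendsto_intros)
  then have path: "((\<lambda>\<epsilon>::real. \<phi> + \<epsilon> *\<^sub>R v) \<longlongrightarrow> \<phi>) (at_right 0)"
    by simp
  have "((\<lambda>\<epsilon>. z (\<phi> + \<epsilon> *\<^sub>R v)) \<longlongrightarrow> z \<phi>) (at_right 0)"
    using has_derivative_continuous[OF z] path by (rule isCont_tendsto_compose)
  then have "((\<lambda>\<epsilon>. ?gap (\<phi> + \<epsilon> *\<^sub>R v)) \<longlongrightarrow> ?gap \<phi>) (at_right 0)"
    by (intro tendsto_intros)
  then have "\<forall>\<^sub>F \<epsilon> in at_right 0. ?gap (\<phi> + \<epsilon> *\<^sub>R v) > 0"
    using pos by (rule order_tendstoD)
  \<comment> \<open>With both gaps positive, each \<open>max 0\<close> drops out, leaving the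
    difference quotient of \<open>z\<close> scaled by \<open>- \<tau> $ j\<close>.\<close>
  then have still_active: "\<forall>\<^sub>F \<epsilon> in at_right 0.
      - (\<tau> $ j * ((z (\<phi> + \<epsilon> *\<^sub>R v) - z \<phi>) /\<^sub>R \<epsilon>) $ j) =
      (boundary_residual m \<tau> z (\<phi> + \<epsilon> *\<^sub>R v) $ j - boundary_residual m \<tau> z \<phi> $ j) / \<epsilon>"
    by eventually_elim
      (use pos in \<open>simp add: boundary_residual_nth divide_inverse algebra_simps\<close>)
  have "((\<lambda>\<epsilon>. - (\<tau> $ j * ((z (\<phi> + \<epsilon> *\<^sub>R v) - z \<phi>) /\<^sub>R \<epsilon>) $ j)) \<longlongrightarrow> - (\<tau> $ j * z' v $ j))
      (at_right 0)"
    by (intro tendsto_minus tendsto_mult tendsto_const tendsto_vec_nth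
        has_derivative_directional_limit[OF z])
  then show ?thesis
    using still_active by (rule Lim_transform_eventually)
qed

theorem proposition1:
  fixes z :: "real ^ 'p \<Rightarrow> real ^ 'n"
    and h :: "real ^ 'n \<Rightarrow> real ^ 'c"
    and \<phi> v :: "real ^ 'p"
    and \<tau> :: "real ^ 'n"
    and m :: real
  assumes "z differentiable (at \<phi>)"
    and "h differentiable (at (z \<phi>))"
    and "\<forall>j. \<tau> $ j \<in> {-1, 1}"
    and "m > 0"
    and "(jacobian h (at (z \<phi>)) ** jacobian z (at \<phi>)) *v v = 0"
    and "(active_mask m \<tau> (z \<phi>) ** jacobian z (at \<phi>)) *v v \<noteq> 0"
  shows "locally_unobservable (\<lambda>x. h (z x)) \<phi> v \<and> boundary_observable m \<tau> z \<phi> v"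
proof
  let ?J = "jacobian z (at \<phi>)" and ?H = "jacobian h (at (z \<phi>))"
  have z: "(z has_derivative (\<lambda>u. ?J *v u)) (at \<phi>)"
    using assms(1) by (simp add: jacobian_works)
  have h: "(h has_derivative (\<lambda>u. ?H *v u)) (at (z \<phi>))"
    using assms(2) by (simp add: jacobian_works)
  show "locally_unobservable (\<lambda>x. h (z x)) \<phi> v"
    using has_derivative_compose[OF z h]
    by (rule locally_unobservable_if_derivative_zero)
      (simp add: matrix_vector_mul_assoc assms(5))
  have "active_mask m \<tau> (z \<phi>) *v (?J *v v) \<noteq> 0"
    using assms(6) by (simp add: matrix_vector_mul_assoc)
  then obtain j where "(active_mask m \<tau> (z \<phi>) *v (?J *v v)) $ j \<noteq> 0"
    by (auto simp: vec_eq_iff)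
  \<comment> \<open>A nonzero product with a 0/1 mask entry forces both the entry to be 1 and the
    other factor to be nonzero.\<close>
  then have active: "active_coord m \<tau> z \<phi> j" and "(?J *v v) $ j \<noteq> 0"
    by (auto simp: active_mask_mult_nth)
  moreover have "\<tau> $ j \<noteq> 0"
    using assms(3)[rule_format, of j] by auto
  ultimately have "- (\<tau> $ j * (?J *v v) $ j) \<noteq> 0"
    by simp
  then show "boundary_observable m \<tau> z \<phi> v"
    unfolding boundary_observable_def
    using active active_residual_directional_limit[OF z active, of v] by blast
qed

end
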